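(* Let $\mathcal{C} = (E, \mathcal{A}, \pi, \mathit{ok}, \vdash, \Vdash)$ be a contract. Then $\mathcal{C}$ admits an agreement if and only if for every $A \in \mathcal{A}$ there exists $G \subseteq E$ such that $\mathit{ok}(A, G)$ and $[\mathcal{C}] \vdash_{\mathrm{PCL}} \pi(e) \;\mathit{says}\; e$ for every $e \in G$.
   Context: A contract is a 6-tuple $\mathcal{C} = (E, \mathcal{A}, \pi, \mathit{ok}, \vdash, \Vdash)$ where $E$ is a finite set of events, $\mathcal{A}$ is a finite set of participants, $\pi : E \to \mathcal{A}$, $\mathit{ok} \subseteq \mathcal{A} \times \mathcal{P}(E)$ satisfies $\mathit{ok}(A,X) \wedge X \subseteq Y \Rightarrow \mathit{ok}(A,Y)$, and $\vdash, \Vdash \subseteq \mathcal{P}(E) \times E$ are saturated: $X \circ e$ and $X \subseteq Y$ imply $Y \circ e$ for $\circ \in \{\vdash, \Vdash\}$. A set $C \subseteq E$ is a configuration iff there exist $e_0, \ldots, e_n$ with $\{e_0,\ldots,e_n\} = C$ such that for every $i \le n$, either $\{e_0,\ldots,e_{i-1}\} \vdash e_i$ or $C \Vdash e_i$. An agreement on $\mathcal{C}$ is a configuration $C$ with $\mathit{ok}(A, C)$ for all $A \in \mathcal{A}$. Propositional Contract Logic (PCL): formulae are built from atoms (here: the events of $E$), $\top$, the intuitionistic connectives ($\wedge, \vee, \rightarrow, \bot$), a binary connective $\twoheadrightarrow$ (contractual implication), and unary modalities $A \;\mathit{says}\; \varphi$ indexed by principals $A$ (here: participants). Provability $\Gamma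 \vdash_{\mathrm{PCL}} \varphi$ is given by the Hilbert system consisting of all axioms of intuitionistic propositional logic, modus ponens, and the axioms $\top \twoheadrightarrow \top$; $(\varphi \twoheadrightarrow \varphi) \rightarrow \varphi$; $(\varphi' \rightarrow \varphi) \rightarrow (\varphi \twoheadrightarrow \psi) \rightarrow (\psi \rightarrow \psi') \rightarrow (\varphi' \twoheadrightarrow \psi')$; $\varphi \rightarrow (A \;\mathit{says}\; \varphi)$; $(A \;\mathit{says}\; A \;\mathit{says}\; \varphi) \rightarrow A \;\mathit{says}\; \varphi$; $(\varphi \rightarrow \psi) \rightarrow (A \;\mathit{says}\; \varphi) \rightarrow (A \;\mathit{says}\; \psi)$. Translation of contracts: for $\circ \in \{\vdash, \Vdash\}$ and a pair $\{d_i : i \in I\} \circ a$, set $[\{d_i : i \in I\} \circ a] = \pi(a) \;\mathit{says}\; \big( (\bigwedge_{i \in I} \pi(d_i) \;\mathit{says}\; d_i) \,[\circ]\, a \big)$, where $[\vdash] = \rightarrow$, $[\Vdash] = \twoheadrightarrow$, and the empty conjunction is $\top$. Then $[\mathcal{C}]$ is the conjunction of $[D \circ a]$ over all pairs $(D,a)$ in $\vdash$ and in $\Vdash$. *)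

theory Defs
  imports "HOL-Library.FuncSet"
begin

record ('e, 'p) contract =
  events :: "'e set"
  participants :: "'p set"
  principal :: "'e \<Rightarrow> 'p"
  ok :: "('p \<times> 'e set) set"
  enables :: "('e set \<times> 'e) set"
  circ_enables :: "('e set \<times> 'e) set"

definition saturated :: "'e set \<Rightarrow> ('e set \<times> 'e) set \<Rightarrow> bool" where
  "saturated E R \<longleftrightarrow> R \<subseteq> Pow E \<times> E \<and>
     (\<forall>X Y e. (X, e) \<in> R \<longrightarrow> X \<subseteq> Y \<longrightarrow> Y \<subseteq> E \<longrightarrow> (Y, e) \<in> R)"

definition is_contract :: "('e, 'p) contract \<Rightarrow> bool" where
  "is_contract \<C> \<longleftrightarrow>
     finite (events \<C>) \<and> finite (participants \<C>) \<and>
     principal \<C> \<in> events \<C> \<rightarrow> participants \<C> \<and>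
     ok \<C> \<subseteq> participants \<C> \<times> Pow (events \<C>) \<and>
     (\<forall>A X Y. (A, X) \<in> ok \<C> \<longrightarrow> X \<subseteq> Y \<longrightarrow> Y \<subseteq> events \<C> \<longrightarrow> (A, Y) \<in> ok \<C>) \<and>
     saturated (events \<C>) (enables \<C>) \<and>
     saturated (events \<C>) (circ_enables \<C>)"

text \<open>The enumeration may be empty, so the empty set is always a configuration, and it may
  contain repetitions.\<close>

definition configuration :: "('e, 'p) contract \<Rightarrow> 'e set \<Rightarrow> bool" where
  "configuration \<C> C \<longleftrightarrow> C \<subseteq> events \<C> \<and>
     (\<exists>es. set es = C \<and>
        (\<forall>i < length es. (set (take i es), es ! i) \<in> enables \<C> \<or> (C, es ! i) \<in> circ_enables \<C>))"

definition agreement :: "('e, 'p) contract \<Rightarrow> 'e set \<Rightarrow> bool" where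
  "agreement \<C> C \<longleftrightarrow> configuration \<C> C \<and> (\<forall>A \<in> participants \<C>. (A, C) \<in> ok \<C>)"

datatype (atoms: 'e, principals: 'p) form =
    Atom 'e
  | Top
  | Bot
  | Conj "('e, 'p) form" "('e, 'p) form"
  | Disj "('e, 'p) form" "('e, 'p) form"
  | Imp "('e, 'p) form" "('e, 'p) form"
  | CImp "('e, 'p) form" "('e, 'p) form"  \<comment> \<open>contractual implication\<close>
  | Says 'p "('e, 'p) form"

definition language :: "'e set \<Rightarrow> 'p set \<Rightarrow> ('e, 'p) form set" where
  "language E P = {\<phi>. atoms \<phi> \<subseteq> E \<and> principals \<phi> \<subseteq> P}"

inductive pcl_axiom :: "('e, 'p) form \<Rightarrow> bool" where
  top: "pcl_axiom Top"
| ex_falso: "pcl_axiom (Imp Bot \<phi>)"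
| imp_K: "pcl_axiom (Imp \<phi> (Imp \<psi> \<phi>))"
| imp_S: "pcl_axiom (Imp (Imp \<phi> (Imp \<psi> \<chi>)) (Imp (Imp \<phi> \<psi>) (Imp \<phi> \<chi>)))"
| conj_elim1: "pcl_axiom (Imp (Conj \<phi> \<psi>) \<phi>)"
| conj_elim2: "pcl_axiom (Imp (Conj \<phi> \<psi>) \<psi>)"
| conj_intro: "pcl_axiom (Imp \<phi> (Imp \<psi> (Conj \<phi> \<psi>)))"
| disj_intro1: "pcl_axiom (Imp \<phi> (Disj \<phi> \<psi>))"
| disj_intro2: "pcl_axiom (Imp \<psi> (Disj \<phi> \<psi>))"
| disj_elim: "pcl_axiom (Imp (Imp \<phi> \<chi>) (Imp (Imp \<psi> \<chi>) (Imp (Disj \<phi> \<psi>) \<chi>)))"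
| cimp_top: "pcl_axiom (CImp Top Top)"
| cimp_fix: "pcl_axiom (Imp (CImp \<phi> \<phi>) \<phi>)"
| cimp_mono: "pcl_axiom (Imp (Imp \<phi>' \<phi>) (Imp (CImp \<phi> \<psi>) (Imp (Imp \<psi> \<psi>') (CImp \<phi>' \<psi>'))))"
| says_unit: "pcl_axiom (Imp \<phi> (Says A \<phi>))"
| says_join: "pcl_axiom (Imp (Says A (Says A \<phi>)) (Says A \<phi>))"
| says_mono: "pcl_axiom (Imp (Imp \<phi> \<psi>) (Imp (Says A \<phi>) (Says A \<psi>)))"

text \<open>Axiom instances are confined to the formulae over the given atoms and principals, hence so
  are all formulae in a derivation whose hypotheses are.\<close>

inductive pcl_provable :: "'e set \<Rightarrow> 'p set \<Rightarrow> ('e, 'p) form set \<Rightarrow> ('e, 'p) form \<Rightarrow> bool"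
  for E P \<Gamma> where
  hyp: "\<phi> \<in> \<Gamma> \<Longrightarrow> pcl_provable E P \<Gamma> \<phi>"
| ax: "pcl_axiom \<phi> \<Longrightarrow> \<phi> \<in> language E P \<Longrightarrow> pcl_provable E P \<Gamma> \<phi>"
| mp: "pcl_provable E P \<Gamma> (Imp \<phi> \<psi>) \<Longrightarrow> pcl_provable E P \<Gamma> \<phi> \<Longrightarrow> pcl_provable E P \<Gamma> \<psi>"

fun conj_list :: "('e, 'p) form list \<Rightarrow> ('e, 'p) form" where
  "conj_list [] = Top"
| "conj_list [\<phi>] = \<phi>"
| "conj_list (\<phi> # \<psi> # \<phi>s) = Conj \<phi> (conj_list (\<psi> # \<phi>s))"

text \<open>Conjunction of a finite set of formulae, taken in an arbitrary but fixed order.\<close>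

definition big_conj :: "('e, 'p) form set \<Rightarrow> ('e, 'p) form" where
  "big_conj S = conj_list (SOME \<phi>s. set \<phi>s = S \<and> distinct \<phi>s)"

definition encode_clause ::
  "('e \<Rightarrow> 'p) \<Rightarrow> (('e, 'p) form \<Rightarrow> ('e, 'p) form \<Rightarrow> ('e, 'p) form) \<Rightarrow> 'e set \<Rightarrow> 'e \<Rightarrow> ('e, 'p) form"
where
  "encode_clause \<pi> imp D a =
     Says (\<pi> a) (imp (big_conj ((\<lambda>d. Says (\<pi> d) (Atom d)) ` D)) (Atom a))"

definition encode :: "('e, 'p) contract \<Rightarrow> ('e, 'p) form" where
  "encode \<C> = big_conj
     ({encode_clause (principal \<C>) Imp D a | D a. (D, a) \<in> enables \<C>} \<union>
      {encode_clause (principal \<C>) CImp D a | D a. (D, a) \<in> circ_enables \<C>})"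

end

theory Submission
  imports Defs
begin

text \<open>
  Both directions pass through the configurations of the contract. For the events of a
  configuration \<open>C\<close>, let \<open>\<Phi>\<close> be the conjunction of all \<open>\<pi> d says d\<close> with \<open>d\<close> in \<open>C\<close>. If
  \<open>\<Phi>\<close> circularly enables \<open>e\<close>, then \<open>CImp \<Phi> e\<close> yields \<open>e\<close> as soon as \<open>e\<close> implies \<open>\<Phi>\<close>;
  so the circularly enabled events can be assumed one at a time, until the remaining ones follow in
  the order of the enumeration.

  Conversely, PCL is sound for Kripke models in which \<open>CImp \<phi> \<psi>\<close> is read as
  \<open>(\<psi> \<rightarrow> \<phi>) \<rightarrow> \<psi>\<close> and the modalities as identities. The sets of events that no
  justified enumeration can enlarge, ordered by inclusion, form such a model. It validates the
  encoding of the contract, and one of its worlds is a configuration, so the events provable from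
  the encoding all belong to that configuration.
\<close>

section \<open>Derivations\<close>

lemma language_simps [simp]:
  "Atom e \<in> language E P \<longleftrightarrow> e \<in> E"
  "Top \<in> language E P"
  "Bot \<in> language E P"
  "Conj \<phi> \<psi> \<in> language E P \<longleftrightarrow> \<phi> \<in> language E P \<and> \<psi> \<in> language E P"
  "Disj \<phi> \<psi> \<in> language E P \<longleftrightarrow> \<phi> \<in> language E P \<and> \<psi> \<in> language E P"
  "Imp \<phi> \<psi> \<in> language E P \<longleftrightarrow> \<phi> \<in> language E P \<and> \<psi> \<in> language E P"
  "CImp \<phi> \<psi> \<in> language E P \<longleftrightarrow> \<phi> \<in> language E P \<and> \<psi> \<in> language E P"
  "Says A \<phi> \<in> language E P \<longleftrightarrow> A \<in> P \<and> \<phi> \<in> language E P"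
  by (auto simp: language_def)

text \<open>Supplies the side condition of \<open>ax\<close> whenever an axiom is instantiated with
  formulae of an existing derivation.\<close>

lemma pcl_provable_language:
  assumes "pcl_provable E P \<Gamma> \<phi>" "\<Gamma> \<subseteq> language E P"
  shows "\<phi> \<in> language E P"
  using assms by induction auto

lemma pcl_provable_mono:
  assumes "pcl_provable E P \<Gamma> \<phi>" "\<Gamma> \<subseteq> \<Delta>"
  shows "pcl_provable E P \<Delta> \<phi>"
  using assms by induction (auto intro: pcl_provable.intros)

lemma pcl_provable_weaken:
  assumes "pcl_provable E P \<Gamma> \<phi>" "\<Gamma> \<subseteq> language E P" "\<psi> \<in> language E P"
  shows "pcl_provable E P \<Gamma> (Imp \<psi> \<phi>)"
  using assms pcl_provable_language[OF assms(1,2)]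
  by (auto intro!: pcl_provable.mp[OF pcl_provable.ax[OF imp_K] assms(1)])

lemma pcl_provable_imp_refl:
  assumes "\<phi> \<in> language E P"
  shows "pcl_provable E P \<Gamma> (Imp \<phi> \<phi>)"
proof -
  have "pcl_provable E P \<Gamma> (Imp (Imp \<phi> (Imp (Imp \<phi> \<phi>) \<phi>)) (Imp (Imp \<phi> (Imp \<phi> \<phi>)) (Imp \<phi> \<phi>)))"
    "pcl_provable E P \<Gamma> (Imp \<phi> (Imp (Imp \<phi> \<phi>) \<phi>))" "pcl_provable E P \<Gamma> (Imp \<phi> (Imp \<phi> \<phi>))"
    using assms by (auto intro!: pcl_provable.ax pcl_axiom.imp_S pcl_axiom.imp_K)
  then show ?thesis by (blast intro: pcl_provable.mp)
qed

text \<open>Modus ponens is the only rule with premises and the modalities are governed by axioms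
  alone, so the usual argument by \<open>imp_K\<close> and \<open>imp_S\<close> goes
  through.\<close>

theorem pcl_deduction:
  assumes "pcl_provable E P (insert \<phi> \<Gamma>) \<psi>" "\<Gamma> \<subseteq> language E P" "\<phi> \<in> language E P"
  shows "pcl_provable E P \<Gamma> (Imp \<phi> \<psi>)"
  using assms(1)
proof induction
  case (hyp \<psi>)
  then show ?case
    using assms by (auto intro: pcl_provable_imp_refl pcl_provable_weaken pcl_provable.hyp)
next
  case (ax \<psi>)
  then show ?case
    using assms by (auto intro: pcl_provable_weaken pcl_provable.ax)
next
  case (mp \<psi> \<chi>)
  have "Imp \<psi> \<chi> \<in> language E P"
    using pcl_provable_language[OF mp.hyps(1)] assms by auto
  then have "pcl_provable E P \<Gamma> (Imp (Imp \<phi> (Imp \<psi> \<chi>)) (Imp (Imp \<phi> \<psi>) (Imp \<phi> \<chi>)))"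
    using assms by (auto intro!: pcl_provable.ax pcl_axiom.imp_S)
  with mp.IH show ?case by (blast intro: pcl_provable.mp)
qed

lemma pcl_provable_says:
  assumes "pcl_provable E P \<Gamma> \<phi>" "\<Gamma> \<subseteq> language E P" "A \<in> P"
  shows "pcl_provable E P \<Gamma> (Says A \<phi>)"
  using assms pcl_provable_language[OF assms(1,2)]
  by (auto intro!: pcl_provable.mp[OF pcl_provable.ax[OF says_unit] assms(1)])

text \<open>Allows working under a modality: \<open>\<phi>\<close> serves as an ordinary hypothesis
  as long as the result goes back under the same principal.\<close>

lemma pcl_provable_says_map:
  assumes "pcl_provable E P \<Gamma> (Says A \<phi>)" "pcl_provable E P (insert \<phi> \<Gamma>) \<psi>" "\<Gamma> \<subseteq> language E P"
  shows "pcl_provable E P \<Gamma> (Says A \<psi>)"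
proof -
  have A: "A \<in> P" "\<phi> \<in> language E P"
    using pcl_provable_language[OF assms(1,3)] by auto
  have imp: "pcl_provable E P \<Gamma> (Imp \<phi> \<psi>)"
    using pcl_deduction[OF assms(2,3) A(2)] .
  have "\<psi> \<in> language E P"
    using pcl_provable_language[OF imp assms(3)] by simp
  then have "pcl_provable E P \<Gamma> (Imp (Imp \<phi> \<psi>) (Imp (Says A \<phi>) (Says A \<psi>)))"
    using A by (auto intro!: pcl_provable.ax pcl_axiom.says_mono)
  with imp assms(1) show ?thesis by (blast intro: pcl_provable.mp)
qed

text \<open>By \<open>cimp_mono\<close> the antecedent may be exchanged for the stronger
  \<open>\<psi>\<close>; the resulting \<open>CImp \<psi> \<psi>\<close> collapses by
  \<open>cimp_fix\<close>.\<close>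

lemma pcl_provable_cimp_elim:
  assumes "pcl_provable E P \<Gamma> (CImp \<phi> \<psi>)" "pcl_provable E P \<Gamma> (Imp \<psi> \<phi>)" "\<Gamma> \<subseteq> language E P"
  shows "pcl_provable E P \<Gamma> \<psi>"
proof -
  have L: "\<phi> \<in> language E P" "\<psi> \<in> language E P"
    using pcl_provable_language[OF assms(1,3)] by auto
  have "pcl_provable E P \<Gamma> (Imp (Imp \<psi> \<phi>) (Imp (CImp \<phi> \<psi>) (Imp (Imp \<psi> \<psi>) (CImp \<psi> \<psi>))))"
    "pcl_provable E P \<Gamma> (Imp (CImp \<psi> \<psi>) \<psi>)" "pcl_provable E P \<Gamma> (Imp \<psi> \<psi>)"
    using L by (auto intro!: pcl_provable.ax pcl_axiom.cimp_mono pcl_axiom.cimp_fix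
        pcl_provable_imp_refl)
  with assms show ?thesis by (blast intro: pcl_provable.mp)
qed

section \<open>Finite conjunctions\<close>

lemma conj_list_Cons:
  "conj_list (\<phi> # \<phi>s) = (if \<phi>s = [] then \<phi> else Conj \<phi> (conj_list \<phi>s))"
  by (cases \<phi>s) auto

lemma conj_list_language: "conj_list \<phi>s \<in> language E P \<longleftrightarrow> set \<phi>s \<subseteq> language E P"
  by (induction \<phi>s) (auto simp: conj_list_Cons simp del: conj_list.simps(2,3))

lemma pcl_provable_Conj:
  assumes "\<Gamma> \<subseteq> language E P"
  shows "pcl_provable E P \<Gamma> (Conj \<phi> \<psi>) \<longleftrightarrow> pcl_provable E P \<Gamma> \<phi> \<and> pcl_provable E P \<Gamma> \<psi>"
proof
  assume *: "pcl_provable E P \<Gamma> (Conj \<phi> \<psi>)"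
  then have "pcl_provable E P \<Gamma> (Imp (Conj \<phi> \<psi>) \<phi>)" "pcl_provable E P \<Gamma> (Imp (Conj \<phi> \<psi>) \<psi>)"
    using pcl_provable_language[OF * assms]
    by (auto intro!: pcl_provable.ax pcl_axiom.conj_elim1 pcl_axiom.conj_elim2)
  with * show "pcl_provable E P \<Gamma> \<phi> \<and> pcl_provable E P \<Gamma> \<psi>" by (blast intro: pcl_provable.mp)
next
  assume *: "pcl_provable E P \<Gamma> \<phi> \<and> pcl_provable E P \<Gamma> \<psi>"
  then have "pcl_provable E P \<Gamma> (Imp \<phi> (Imp \<psi> (Conj \<phi> \<psi>)))"
    using pcl_provable_language[OF _ assms]
    by (auto intro!: pcl_provable.ax pcl_axiom.conj_intro)
  with * show "pcl_provable E P \<Gamma> (Conj \<phi> \<psi>)" by (blast intro: pcl_provable.mp)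
qed

lemma pcl_provable_conj_list:
  assumes "\<Gamma> \<subseteq> language E P"
  shows "pcl_provable E P \<Gamma> (conj_list \<phi>s) \<longleftrightarrow> (\<forall>\<phi> \<in> set \<phi>s. pcl_provable E P \<Gamma> \<phi>)"
  by (induction \<phi>s)
    (auto simp: conj_list_Cons pcl_provable_Conj[OF assms] simp del: conj_list.simps(2,3)
      intro: pcl_provable.ax pcl_axiom.top)

lemma big_conj_conj_list:
  assumes "finite S"
  obtains \<phi>s where "set \<phi>s = S" "big_conj S = conj_list \<phi>s"
proof -
  have "\<exists>\<phi>s. set \<phi>s = S \<and> distinct \<phi>s" using finite_distinct_list[OF assms] .
  from someI_ex[OF this] show ?thesis using that unfolding big_conj_def by blast
qed

lemma big_conj_language: "finite S \<Longrightarrow> big_conj S \<in> language E P \<longleftrightarrow> S \<subseteq> language E P"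
  by (metis big_conj_conj_list conj_list_language)

lemma pcl_provable_big_conj:
  assumes "finite S" "\<Gamma> \<subseteq> language E P"
  shows "pcl_provable E P \<Gamma> (big_conj S) \<longleftrightarrow> (\<forall>\<phi> \<in> S. pcl_provable E P \<Gamma> \<phi>)"
  using assms by (metis big_conj_conj_list pcl_provable_conj_list)

section \<open>Kripke semantics\<close>

text \<open>A world doubles as the set of atoms true at it; \<open>W\<close> collects the worlds
  over which the implications quantify.\<close>

fun forces :: "'e set set \<Rightarrow> 'e set \<Rightarrow> ('e, 'p) form \<Rightarrow> bool" where
  "forces W M (Atom e) \<longleftrightarrow> e \<in> M"
| "forces W M Top \<longleftrightarrow> True"
| "forces W M Bot \<longleftrightarrow> False"
| "forces W M (Conj \<phi> \<psi>) \<longleftrightarrow> forces W M \<phi> \<and> forces W M \<psi>"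
| "forces W M (Disj \<phi> \<psi>) \<longleftrightarrow> forces W M \<phi> \<or> forces W M \<psi>"
| "forces W M (Imp \<phi> \<psi>) \<longleftrightarrow> (\<forall>N \<in> W. M \<subseteq> N \<longrightarrow> forces W N \<phi> \<longrightarrow> forces W N \<psi>)"
| "forces W M (CImp \<phi> \<psi>) \<longleftrightarrow>
     (\<forall>N \<in> W. M \<subseteq> N \<longrightarrow> (\<forall>K \<in> W. N \<subseteq> K \<longrightarrow> forces W K \<psi> \<longrightarrow> forces W K \<phi>) \<longrightarrow> forces W N \<psi>)"
| "forces W M (Says A \<phi>) \<longleftrightarrow> forces W M \<phi>"

text \<open>The clauses of both implications range over all larger worlds, so a step upwards leaves
  fewer instances to check. This persistence validates \<open>imp_K\<close> and
  \<open>conj_intro\<close>.\<close>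

lemma forces_mono:
  "forces W M \<phi> \<Longrightarrow> M \<subseteq> N \<Longrightarrow> forces W N \<phi>"
proof (induction \<phi> arbitrary: M N)
  case (Imp \<phi> \<psi>)
  from Imp.prems show ?case unfolding forces.simps by (meson order_trans)
next
  case (CImp \<phi> \<psi>)
  from CImp.prems show ?case unfolding forces.simps by (meson order_trans)
next
  case (Disj \<phi> \<psi>)
  then show ?case by (meson forces.simps(5))
qed auto

text \<open>Since \<open>Says\<close> is transparent, its axioms become tautologies;
  \<open>cimp_fix\<close> holds because the inner implication in the reading of
  \<open>CImp \<phi> \<phi>\<close> is trivial.\<close>

lemma forces_pcl_axiom: "pcl_axiom \<phi> \<Longrightarrow> M \<in> W \<Longrightarrow> forces W M \<phi>"
proof (induction rule: pcl_axiom.induct)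
  case (cimp_mono \<phi>' \<phi> \<psi> \<psi>')
  show ?case
    unfolding forces.simps
  proof (intro ballI impI)
    fix M1 M2 M3 N
    assume *: "M1 \<subseteq> M2" "M2 \<subseteq> M3" "N \<in> W" "M3 \<subseteq> N"
      and 1: "\<forall>K\<in>W. M1 \<subseteq> K \<longrightarrow> forces W K \<phi>' \<longrightarrow> forces W K \<phi>"
      and 2: "\<forall>N\<in>W. M2 \<subseteq> N \<longrightarrow>
        (\<forall>K\<in>W. N \<subseteq> K \<longrightarrow> forces W K \<psi> \<longrightarrow> forces W K \<phi>) \<longrightarrow> forces W N \<psi>"
      and 3: "\<forall>K\<in>W. M3 \<subseteq> K \<longrightarrow> forces W K \<psi> \<longrightarrow> forces W K \<psi>'"
      and 4: "\<forall>K\<in>W. N \<subseteq> K \<longrightarrow> forces W K \<psi>' \<longrightarrow> forces W K \<phi>'"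
    \<comment> \<open>Above \<open>N\<close>, \<open>\<psi>\<close> gives \<open>\<psi>'\<close> by
      3, then \<open>\<phi>'\<close> by 4, then \<open>\<phi>\<close> by 1. This is the premise
      under which 2 releases \<open>\<psi>\<close> at \<open>N\<close>.\<close>
    have "\<forall>K\<in>W. N \<subseteq> K \<longrightarrow> forces W K \<psi> \<longrightarrow> forces W K \<phi>"
      using * 1 3 4 by (meson order_trans)
    then have "forces W N \<psi>" using * 2 by (meson order_trans)
    then show "forces W N \<psi>'" using * 3 by blast
  qed
next
  case (imp_K \<phi> \<psi>)
  then show ?case using forces_mono by (simp, blast)
next
  case (conj_intro \<phi> \<psi>)
  then show ?case using forces_mono by (simp, blast)
next
  case (imp_S \<phi> \<psi> \<chi>)
  show ?case unfolding forces.simps by (meson order_trans order_refl)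
next
  case (disj_elim \<phi> \<chi> \<psi>)
  show ?case unfolding forces.simps by (meson order_trans)
qed auto

lemma forces_pcl_provable:
  assumes "pcl_provable E P \<Gamma> \<phi>" "M \<in> W" "\<And>\<gamma>. \<gamma> \<in> \<Gamma> \<Longrightarrow> forces W M \<gamma>"
  shows "forces W M \<phi>"
  using assms by induction (auto intro: forces_pcl_axiom)

lemma forces_conj_list: "forces W M (conj_list \<phi>s) \<longleftrightarrow> (\<forall>\<phi> \<in> set \<phi>s. forces W M \<phi>)"
  by (induction \<phi>s) (auto simp: conj_list_Cons simp del: conj_list.simps(2,3))

lemma forces_big_conj: "finite S \<Longrightarrow> forces W M (big_conj S) \<longleftrightarrow> (\<forall>\<phi> \<in> S. forces W M \<phi>)"
  by (metis big_conj_conj_list forces_conj_list)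

section \<open>Justified enumerations\<close>

text \<open>The condition on configurations relative to a set \<open>X\<close> of events taken as
  already performed, so that extensions can be composed.\<close>

definition justified :: "('e, 'p) contract \<Rightarrow> 'e set \<Rightarrow> 'e list \<Rightarrow> bool" where
  "justified \<C> X es \<longleftrightarrow> (\<forall>i < length es. (X \<union> set (take i es), es ! i) \<in> enables \<C> \<or>
     (X \<union> set es, es ! i) \<in> circ_enables \<C>)"

text \<open>Closure is under whole enumerations and not single events: two events that circularly
  enable each other may be justified only jointly.\<close>

definition closed_worlds :: "('e, 'p) contract \<Rightarrow> 'e set set" where
  "closed_worlds \<C> = {M. M \<subseteq> events \<C> \<and> (\<forall>es. justified \<C> M es \<longrightarrow> set es \<subseteq> M)}"

locale wf_contract =
  fixes \<C> :: "('e, 'p) contract"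
  assumes is_contract: "is_contract \<C>"
begin

abbreviation provable :: "('e, 'p) form set \<Rightarrow> ('e, 'p) form \<Rightarrow> bool" where
  "provable \<equiv> pcl_provable (events \<C>) (participants \<C>)"

abbreviation lang :: "('e, 'p) form set" where
  "lang \<equiv> language (events \<C>) (participants \<C>)"

abbreviation promise :: "'e \<Rightarrow> ('e, 'p) form" where
  "promise e \<equiv> Says (principal \<C> e) (Atom e)"

lemma finite_events: "finite (events \<C>)"
  using is_contract by (simp add: is_contract_def)

lemma principal_in: "e \<in> events \<C> \<Longrightarrow> principal \<C> e \<in> participants \<C>"
  using is_contract by (auto simp: is_contract_def)

lemma ok_mono: "(A, X) \<in> ok \<C> \<Longrightarrow> X \<subseteq> Y \<Longrightarrow> Y \<subseteq> events \<C> \<Longrightarrow> (A, Y) \<in> ok \<C>"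
  using is_contract by (auto simp: is_contract_def)

lemma enables_sub: "enables \<C> \<subseteq> Pow (events \<C>) \<times> events \<C>"
  and circ_enables_sub: "circ_enables \<C> \<subseteq> Pow (events \<C>) \<times> events \<C>"
  using is_contract by (simp_all add: is_contract_def saturated_def)

lemma enables_mono: "(X, e) \<in> enables \<C> \<Longrightarrow> X \<subseteq> Y \<Longrightarrow> Y \<subseteq> events \<C> \<Longrightarrow> (Y, e) \<in> enables \<C>"
  using is_contract unfolding is_contract_def saturated_def by blast

lemma circ_enables_mono:
  "(X, e) \<in> circ_enables \<C> \<Longrightarrow> X \<subseteq> Y \<Longrightarrow> Y \<subseteq> events \<C> \<Longrightarrow> (Y, e) \<in> circ_enables \<C>"
  using is_contract unfolding is_contract_def saturated_def by blast

lemma justified_events: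
  assumes "justified \<C> X es"
  shows "set es \<subseteq> events \<C>"
proof
  fix e assume "e \<in> set es"
  then obtain i where "i < length es" "es ! i = e" by (auto simp: in_set_conv_nth)
  with assms have "(X \<union> set (take i es), e) \<in> enables \<C> \<or> (X \<union> set es, e) \<in> circ_enables \<C>"
    unfolding justified_def by blast
  then show "e \<in> events \<C>" using enables_sub circ_enables_sub by blast
qed

lemma configuration_justified: "configuration \<C> C \<longleftrightarrow> (\<exists>es. set es = C \<and> justified \<C> {} es)"
proof -
  have "justified \<C> {} es \<longleftrightarrow> (\<forall>i < length es.
      (set (take i es), es ! i) \<in> enables \<C> \<or> (set es, es ! i) \<in> circ_enables \<C>)" for es
    by (simp add: justified_def)
  then show ?thesis
    unfolding configuration_def using justified_events by metis
qed

text \<open>The circular justifications in \<open>es\<close> refer to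
  \<open>X \<union> set es\<close>; saturation carries them over to the larger final set.\<close>

lemma justified_append:
  assumes "justified \<C> X es" "justified \<C> (X \<union> set es) fs" "X \<subseteq> events \<C>"
  shows "justified \<C> X (es @ fs)"
  unfolding justified_def
proof (intro allI impI)
  fix i assume i: "i < length (es @ fs)"
  have sub: "X \<union> set (es @ fs) \<subseteq> events \<C>"
    using assms justified_events by auto
  show "(X \<union> set (take i (es @ fs)), (es @ fs) ! i) \<in> enables \<C> \<or>
      (X \<union> set (es @ fs), (es @ fs) ! i) \<in> circ_enables \<C>"
  proof (cases "i < length es")
    case True
    then show ?thesis
      using assms(1) sub circ_enables_mono[of "X \<union> set es" "es ! i" "X \<union> set (es @ fs)"]
      by (auto simp: justified_def nth_append)
  next
    case False
    then have "i - length es < length fs" using i by auto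
    then show ?thesis
      using assms(2) False by (auto simp: justified_def nth_append Un_assoc)
  qed
qed

text \<open>A justified enumeration covering as many events as possible works: by
  \<open>justified_append\<close>, any further one over its result would compete with it.\<close>

lemma ex_closed_world:
  assumes "X \<subseteq> events \<C>"
  obtains es where "justified \<C> X es" "X \<union> set es \<in> closed_worlds \<C>"
proof -
  have bound: "card (X \<union> set es) \<le> card (events \<C>)" if "justified \<C> X es" for es
    using that assms justified_events finite_events by (intro card_mono) auto
  have "justified \<C> X []" by (simp add: justified_def)
  \<comment> \<open>Enumerations may repeat events and so have unbounded length; the number of
    covered events is bounded and is maximised instead.\<close>
  then obtain es where es: "justified \<C> X es"
    and max: "\<And>fs. justified \<C> X fs \<Longrightarrow> card (X \<union> set fs) \<le> card (X \<union> set es)"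
    using ex_has_greatest_nat[of "justified \<C> X" "[]" "\<lambda>es. card (X \<union> set es)" "Suc (card (events \<C>))"]
      bound by (metis le_imp_less_Suc less_imp_le)
  have "set fs \<subseteq> X \<union> set es" if fs: "justified \<C> (X \<union> set es) fs" for fs
  proof -
    have ap: "justified \<C> X (es @ fs)" using justified_append[OF es fs assms] .
    have "finite (X \<union> set (es @ fs))"
      using assms finite_events by (auto intro: finite_subset)
    then have "X \<union> set es = X \<union> set (es @ fs)"
      using max[OF ap] by (intro card_seteq) auto
    then show ?thesis by auto
  qed
  then show ?thesis
    using that es assms justified_events by (auto simp: closed_worlds_def)
qed

section \<open>The encoding\<close>

text \<open>Ensures that the choice of a list in \<open>big_conj\<close> succeeds for the
  encoding.\<close>

lemma finite_clauses:
  "finite ({encode_clause (principal \<C>) Imp D a | D a. (D, a) \<in> enables \<C>} \<union>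
      {encode_clause (principal \<C>) CImp D a | D a. (D, a) \<in> circ_enables \<C>})" (is "finite ?S")
proof -
  have "finite (enables \<C>)" "finite (circ_enables \<C>)"
    using finite_events enables_sub circ_enables_sub by (auto intro: finite_subset)
  moreover have "?S = (\<lambda>(D, a). encode_clause (principal \<C>) Imp D a) ` enables \<C> \<union>
      (\<lambda>(D, a). encode_clause (principal \<C>) CImp D a) ` circ_enables \<C>"
    by auto
  ultimately show ?thesis by simp
qed

lemma promises_language:
  "D \<subseteq> events \<C> \<Longrightarrow> big_conj (promise ` D) \<in> lang"
  using finite_events principal_in by (subst big_conj_language) (auto intro: finite_subset)

lemma encode_language: "encode \<C> \<in> lang"
  using promises_language principal_in enables_sub circ_enables_sub
  unfolding encode_def big_conj_language[OF finite_clauses] by (auto simp: encode_clause_def)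

section \<open>From configurations to derivations of promises\<close>

lemma provable_clauses:
  assumes "encode \<C> \<in> \<Gamma>" "\<Gamma> \<subseteq> lang"
  shows "(D, a) \<in> enables \<C> \<Longrightarrow>
      provable \<Gamma> (Says (principal \<C> a) (Imp (big_conj (promise ` D)) (Atom a)))"
    and "(D, a) \<in> circ_enables \<C> \<Longrightarrow>
      provable \<Gamma> (Says (principal \<C> a) (CImp (big_conj (promise ` D)) (Atom a)))"
proof -
  have "provable \<Gamma> (encode \<C>)" using assms(1) by (rule pcl_provable.hyp)
  note clauses = this[unfolded encode_def pcl_provable_big_conj[OF finite_clauses assms(2)]]
  show "(D, a) \<in> enables \<C> \<Longrightarrow>
      provable \<Gamma> (Says (principal \<C> a) (Imp (big_conj (promise ` D)) (Atom a)))"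
    and "(D, a) \<in> circ_enables \<C> \<Longrightarrow>
      provable \<Gamma> (Says (principal \<C> a) (CImp (big_conj (promise ` D)) (Atom a)))"
    using clauses unfolding encode_clause_def by blast+
qed

lemma provable_promises:
  assumes "\<Gamma> \<subseteq> lang" "D \<subseteq> events \<C>"
  shows "provable \<Gamma> (big_conj (promise ` D)) \<longleftrightarrow> (\<forall>d \<in> D. provable \<Gamma> (promise d))"
  using pcl_provable_big_conj[of "promise ` D", OF _ assms(1)] assms(2) finite_events
  by (auto dest: finite_subset)

text \<open>\<open>\<Gamma>\<close> varies because promises are added as hypotheses; the induction
  counts the circularly enabled events of \<open>C\<close> whose promise is not yet assumed.\<close>

lemma configuration_provable_aux:
  assumes "set es = C" "justified \<C> {} es" "C \<subseteq> events \<C>" "encode \<C> \<in> \<Gamma>" "\<Gamma> \<subseteq> lang" "e \<in> C"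
  shows "provable \<Gamma> (promise e)"
  using assms(4,5,6)
proof (induction "card {c \<in> C. (C, c) \<in> circ_enables \<C> \<and> promise c \<notin> \<Gamma>}"
    arbitrary: \<Gamma> e rule: less_induct)
  case less
  have circ: "provable \<Gamma> (promise c)" if c: "c \<in> C" "(C, c) \<in> circ_enables \<C>" for c
  proof (cases "promise c \<in> \<Gamma>")
    case True
    then show ?thesis by (rule pcl_provable.hyp)
  next
    case False
    let ?\<Phi> = "big_conj (promise ` C)"
    have L: "promise c \<in> lang" "insert (promise c) \<Gamma> \<subseteq> lang"
      using c assms(3) principal_in less.prems(2) by auto
    have "card {d \<in> C. (C, d) \<in> circ_enables \<C> \<and> promise d \<notin> insert (promise c) \<Gamma>}
        < card {d \<in> C. (C, d) \<in> circ_enables \<C> \<and> promise d \<notin> \<Gamma>}"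
      using c False assms(1) by (intro psubset_card_mono) auto
    \<comment> \<open>With the promise of \<open>c\<close> assumed the count drops, so all promises
      of \<open>C\<close> are derivable.\<close>
    from less.hyps[OF this] have "provable (insert (promise c) \<Gamma>) ?\<Phi>"
      using L less.prems(1) provable_promises[OF L(2) assms(3)] by auto
    then have imp: "provable \<Gamma> (Imp (promise c) ?\<Phi>)"
      using pcl_deduction less.prems(2) L(1) by blast
    \<comment> \<open>The clause for \<open>c\<close> with its modality stripped; the modality is
      restored at the end by \<open>pcl_provable_says_map\<close>.\<close>
    let ?\<Delta> = "insert (CImp ?\<Phi> (Atom c)) \<Gamma>"
    have \<Delta>: "?\<Delta> \<subseteq> lang"
      using promises_language[OF assms(3)] c assms(3) less.prems(2) by auto
    have "insert (Atom c) ?\<Delta> \<subseteq> lang" using \<Delta> c assms(3) by auto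
    \<comment> \<open>\<open>Atom c\<close> yields its own promise by \<open>says_unit\<close>,
      hence \<open>?\<Phi>\<close> by \<open>imp\<close>: the premise for eliminating the
      contractual implication.\<close>
    then have "provable (insert (Atom c) ?\<Delta>) (promise c)"
      using c assms(3) principal_in by (auto intro!: pcl_provable_says intro: pcl_provable.hyp)
    moreover have "provable (insert (Atom c) ?\<Delta>) (Imp (promise c) ?\<Phi>)"
      using imp by (rule pcl_provable_mono) auto
    ultimately have "provable (insert (Atom c) ?\<Delta>) ?\<Phi>" by (blast intro: pcl_provable.mp)
    then have "provable ?\<Delta> (Imp (Atom c) ?\<Phi>)"
      using pcl_deduction[OF _ \<Delta>] c assms(3) by auto
    then have "provable ?\<Delta> (Atom c)"
      using pcl_provable_cimp_elim[OF _ _ \<Delta>] pcl_provable.hyp[of _ ?\<Delta>] by blast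
    then show ?thesis
      using pcl_provable_says_map[OF provable_clauses(2)[OF less.prems(1,2) c(2)] _ less.prems(2)]
      by blast
  qed
  \<comment> \<open>A second induction follows the enumeration: an event enabled by its predecessors
    uses their promises, any other one falls under \<open>circ\<close>.\<close>
  have "provable \<Gamma> (promise (es ! i))" if "i < length es" for i
    using that
  proof (induction i rule: less_induct)
    case (less i)
    note \<Gamma> = \<open>encode \<C> \<in> \<Gamma>\<close> \<open>\<Gamma> \<subseteq> lang\<close>
    show ?case
    proof (cases "(set (take i es), es ! i) \<in> enables \<C>")
      case True
      let ?\<Psi> = "big_conj (promise ` set (take i es))"
      have sub: "set (take i es) \<subseteq> events \<C>"
        using assms(1,3) set_take_subset by fast
      have "\<forall>d \<in> set (take i es). provable \<Gamma> (promise d)"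
        using less by (auto simp: in_set_conv_nth)
      then have "provable \<Gamma> ?\<Psi>"
        using provable_promises[OF \<Gamma>(2) sub] by blast
      then have "provable (insert (Imp ?\<Psi> (Atom (es ! i))) \<Gamma>) ?\<Psi>"
        by (rule pcl_provable_mono) auto
      then have "provable (insert (Imp ?\<Psi> (Atom (es ! i))) \<Gamma>) (Atom (es ! i))"
        by (blast intro: pcl_provable.mp pcl_provable.hyp)
      then show ?thesis
        using pcl_provable_says_map[OF provable_clauses(1)[OF \<Gamma> True] _ \<Gamma>(2)] by blast
    next
      case False
      then show ?thesis
        using assms(1,2) circ less.prems by (auto simp: justified_def)
    qed
  qed
  with less.prems(3) assms(1) show ?case by (auto simp: in_set_conv_nth)
qed

lemma configuration_provable:
  assumes "configuration \<C> C" "e \<in> C"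
  shows "provable {encode \<C>} (promise e)"
  using assms configuration_provable_aux[of _ C "{encode \<C>}"] encode_language justified_events
  unfolding configuration_justified by blast

section \<open>From derivations back to configurations\<close>

lemma forces_promises:
  assumes "D \<subseteq> events \<C>"
  shows "forces W M (big_conj (promise ` D)) \<longleftrightarrow> D \<subseteq> M"
proof -
  have "finite (promise ` D)" using assms finite_events by (auto dest: finite_subset)
  then show ?thesis by (auto simp: forces_big_conj)
qed

text \<open>By saturation \<open>M\<close> itself enables \<open>a\<close>, so the one-element
  enumeration \<open>[a]\<close> is justified over \<open>M\<close>.\<close>

lemma closed_world_enables:
  assumes "M \<in> closed_worlds \<C>" "(D, a) \<in> enables \<C>" "D \<subseteq> M"
  shows "a \<in> M"
proof -
  have "(M, a) \<in> enables \<C>"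
    using assms enables_mono by (auto simp: closed_worlds_def)
  then have "justified \<C> M [a]" by (simp add: justified_def)
  with assms(1) have "set [a] \<subseteq> M" unfolding closed_worlds_def by blast
  then show ?thesis by simp
qed

text \<open>Enlarge \<open>insert a M\<close> by \<open>es\<close> to a closed world. It contains
  \<open>a\<close>, hence \<open>D\<close>, hence it circularly enables \<open>a\<close>; so
  \<open>a # es\<close> is justified over \<open>M\<close> and cannot leave
  \<open>M\<close>.\<close>

lemma closed_world_circ_enables:
  assumes M: "M \<in> closed_worlds \<C>" and Da: "(D, a) \<in> circ_enables \<C>"
    and imp: "\<And>K. K \<in> closed_worlds \<C> \<Longrightarrow> M \<subseteq> K \<Longrightarrow> a \<in> K \<Longrightarrow> D \<subseteq> K"
  shows "a \<in> M"
proof -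
  have sub: "insert a M \<subseteq> events \<C>"
    using M Da circ_enables_sub by (auto simp: closed_worlds_def)
  then obtain es where es: "justified \<C> (insert a M) es" "insert a M \<union> set es \<in> closed_worlds \<C>"
    using ex_closed_world by metis
  have "D \<subseteq> insert a M \<union> set es" using imp[OF es(2)] by auto
  then have circ: "(M \<union> set (a # es), a) \<in> circ_enables \<C>"
    using circ_enables_mono[OF Da] sub justified_events[OF es(1)] by auto
  have "justified \<C> M (a # es)"
    unfolding justified_def
  proof (intro allI impI)
    fix i assume "i < length (a # es)"
    then show "(M \<union> set (take i (a # es)), (a # es) ! i) \<in> enables \<C> \<or>
        (M \<union> set (a # es), (a # es) ! i) \<in> circ_enables \<C>"
      \<comment> \<open>Position 0 holds by \<open>circ\<close>; later prefixes of
        \<open>a # es\<close> over \<open>M\<close> are prefixes of \<open>es\<close> over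
        \<open>insert a M\<close>.\<close>
      using circ es(1) by (cases i) (auto simp: justified_def)
  qed
  with M have "set (a # es) \<subseteq> M" unfolding closed_worlds_def by blast
  then show ?thesis by simp
qed

lemma forces_encode:
  assumes "M \<in> closed_worlds \<C>"
  shows "forces (closed_worlds \<C>) M (encode \<C>)"
proof -
  have "forces (closed_worlds \<C>) M (encode_clause (principal \<C>) Imp D a)"
    if "(D, a) \<in> enables \<C>" for D a
  proof -
    have "D \<subseteq> events \<C>" using that enables_sub by auto
    then show ?thesis
      using closed_world_enables that by (auto simp: encode_clause_def forces_promises)
  qed
  moreover have "forces (closed_worlds \<C>) M (encode_clause (principal \<C>) CImp D a)"
    if "(D, a) \<in> circ_enables \<C>" for D a
  proof -
    have "D \<subseteq> events \<C>" using that circ_enables_sub by auto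
    then show ?thesis
      using closed_world_circ_enables that
      by (simp add: encode_clause_def forces_promises)
  qed
  ultimately show ?thesis
    unfolding encode_def forces_big_conj[OF finite_clauses] by blast
qed

text \<open>The closed world grown from the empty set is at once a configuration and a world forcing
  the encoding, so soundness applies at it.\<close>

lemma ex_configuration_of_provable:
  obtains R where "configuration \<C> R" "\<And>e. provable {encode \<C>} (promise e) \<Longrightarrow> e \<in> R"
proof -
  obtain es where es: "justified \<C> {} es" "set es \<in> closed_worlds \<C>"
    using ex_closed_world[of "{}"] by auto
  have "e \<in> set es" if "provable {encode \<C>} (promise e)" for e
    using forces_pcl_provable[OF that es(2)] forces_encode[OF es(2)] by simp
  with that es(1) show ?thesis using configuration_justified by blast
qed

end

theorem theorem3:
  fixes \<C> :: "('e, 'p) contract"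
  assumes "is_contract \<C>"
  shows "(\<exists>C. agreement \<C> C) \<longleftrightarrow>
    (\<forall>A \<in> participants \<C>. \<exists>G \<subseteq> events \<C>. (A, G) \<in> ok \<C> \<and>
       (\<forall>e \<in> G. pcl_provable (events \<C>) (participants \<C>) {encode \<C>}
                  (Says (principal \<C> e) (Atom e))))"
proof -
  interpret wf_contract \<C> by unfold_locales (rule assms)
  show ?thesis
  proof
    assume "\<exists>C. agreement \<C> C"
    then obtain C where "configuration \<C> C" "C \<subseteq> events \<C>" "\<forall>A \<in> participants \<C>. (A, C) \<in> ok \<C>"
      by (auto simp: agreement_def configuration_def)
    \<comment> \<open>The agreement \<open>C\<close> itself serves as \<open>G\<close> for every
      participant.\<close>
    then show "\<forall>A \<in> participants \<C>. \<exists>G \<subseteq> events \<C>. (A, G) \<in> ok \<C> \<and>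
        (\<forall>e \<in> G. provable {encode \<C>} (promise e))"
      using configuration_provable by blast
  next
    assume *: "\<forall>A \<in> participants \<C>. \<exists>G \<subseteq> events \<C>. (A, G) \<in> ok \<C> \<and>
        (\<forall>e \<in> G. provable {encode \<C>} (promise e))"
    obtain R where R: "configuration \<C> R" "\<And>e. provable {encode \<C>} (promise e) \<Longrightarrow> e \<in> R"
      using ex_configuration_of_provable by blast
    have "R \<subseteq> events \<C>" using R(1) by (simp add: configuration_def)
    \<comment> \<open>Each \<open>G\<close> lies inside the single configuration \<open>R\<close>,
      and \<open>ok\<close> is upward closed.\<close>
    then have "(A, R) \<in> ok \<C>" if "A \<in> participants \<C>" for A
      using * R(2) ok_mono that by (meson subsetI)
    with R(1) show "\<exists>C. agreement \<C> C" by (auto simp: agreement_def)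
  qed
qed

end
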